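(* Let $\mathbf H_{ii}\in\mathbb C^{N_{\mathrm r}\times N_{\mathrm t}}$ be the self-interference channel, $\mathbf F_{\mathrm{RF}}\in\mathbb C^{N_{\mathrm t}\times L_{\mathrm t}}$ the analog precoder of a full-duplex device transmitting $N_{\mathrm s}\ge 1$ streams, and $\eta_{\mathrm{LNA}}\ge 0$. If $$\eta_{\mathrm{LNA}}\ \ge\ \frac1{N_{\mathrm s}}\,\sigma_{\max}^2(\mathbf H_{ii}\mathbf F_{\mathrm{RF}}),$$ then the per-antenna constraint is implied by the precoding power constraint: every digital precoder $\mathbf F_{\mathrm{BB}}\in\mathbb C^{L_{\mathrm t}\times N_{\mathrm s}}$ with $\|\mathbf F_{\mathrm{BB}}\|_{\mathrm F}^2\le 1$ satisfies $$\frac1{N_{\mathrm s}}\,\sigma_{\max}^2(\mathbf H_{ii}\mathbf F_{\mathrm{RF}}\mathbf F_{\mathrm{BB}})\le\eta_{\mathrm{LNA}}.$$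
   Context: $\|\cdot\|_{\mathrm F}$ is the Frobenius norm and $\sigma_{\max}(\mathbf A)$ the largest singular value of $\mathbf A$. The precoding power constraint is $\|\mathbf F_{\mathrm{BB}}\|_{\mathrm F}^2\le 1$. The per-antenna (LNA) self-interference power constraint is $\frac1{N_{\mathrm s}}\sigma_{\max}^2(\mathbf H_{ii}\mathbf F_{\mathrm{RF}}\mathbf F_{\mathrm{BB}})\le\eta_{\mathrm{LNA}}$, where $\eta_{\mathrm{LNA}}$ is a unitless threshold. The matrix dimensions $N_{\mathrm t},N_{\mathrm r},L_{\mathrm t}$ (numbers of transmit antennas, receive antennas, transmit RF chains) are positive integers. *)

theory Defs
  imports
    "Jordan_Normal_Form.Schur_Decomposition"
    "Jordan_Normal_Form.Spectral_Radius"
begin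

definition frobenius_norm :: "complex mat \<Rightarrow> real" where
  "frobenius_norm A = sqrt (\<Sum>i<dim_row A. \<Sum>j<dim_col A. (cmod (A $$ (i, j)))\<^sup>2)"

text \<open>
  The singular values of \<open>A\<close> are the nonnegative square roots of the eigenvalues of
  \<open>A\<^sup>H A\<close>. If \<open>A\<close> has more columns than rows, this set always contains \<open>0\<close>, also when only the
  first \<open>min (dim_row A) (dim_col A)\<close> roots are counted as singular values elsewhere; the
  maximum is the same under both conventions.
\<close>

definition singular_values :: "complex mat \<Rightarrow> real set" where
  "singular_values A =
     {s. 0 \<le> s \<and> eigenvalue (mat_adjoint A * A) (complex_of_real (s\<^sup>2))}"

definition sigma_max :: "complex mat \<Rightarrow> real" where
  "sigma_max A = Max (singular_values A)"

lemma mat_adjoint_carrier: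
  assumes "A \<in> carrier_mat m n"
  shows "mat_adjoint A \<in> carrier_mat n m"
  using assms by (auto simp: mat_adjoint_def)

lemma mat_adjoint_index:
  assumes "A \<in> carrier_mat m n" "i < n" "j < m"
  shows "mat_adjoint A $$ (i, j) = conjugate (A $$ (j, i))"
  using assms by (auto simp: mat_adjoint_def mat_of_rows_index)

text \<open>For \<open>dim_col A > 0\<close> the maximum in \<open>sigma_max\<close> ranges over a finite nonempty set.\<close>

lemma finite_singular_values: "finite (singular_values A)"
proof -
  have "mat_adjoint A * A \<in> carrier_mat (dim_col A) (dim_col A)"
    by (auto simp: mat_adjoint_def)
  then have "finite (spectrum (mat_adjoint A * A))"
    by (rule card_finite_spectrum)
  moreover have "inj_on (\<lambda>s. complex_of_real (s\<^sup>2)) (singular_values A)"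
    by (auto simp: inj_on_def singular_values_def simp flip: of_real_power)
  moreover have "(\<lambda>s. complex_of_real (s\<^sup>2)) ` singular_values A \<subseteq> spectrum (mat_adjoint A * A)"
    by (auto simp: singular_values_def spectrum_def)
  ultimately show ?thesis
    by (metis finite_imageD finite_subset)
qed

lemma singular_values_nonempty:
  assumes "dim_col A > 0"
  shows "singular_values A \<noteq> {}"
proof -
  define m n where "m = dim_row A" and "n = dim_col A"
  have A: "A \<in> carrier_mat m n" and H: "mat_adjoint A \<in> carrier_mat n m"
    by (auto simp: m_def n_def mat_adjoint_def)
  then have G: "mat_adjoint A * A \<in> carrier_mat n n" by auto
  from spectrum_non_empty[OF G] assms obtain l v
    where "eigenvector (mat_adjoint A * A) v l" and l: "eigenvalue (mat_adjoint A * A) l"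
    by (auto simp: n_def spectrum_def eigenvalue_def)
  then have v: "v \<in> carrier_vec n" "v \<noteq> 0\<^sub>v n" and e: "(mat_adjoint A * A) *\<^sub>v v = l \<cdot>\<^sub>v v"
    using G H by (auto simp: eigenvector_def)
  define w where "w = A *\<^sub>v v"
  have w: "w \<in> carrier_vec m" using A v by (auto simp: w_def)
  have "(mat_adjoint A *\<^sub>v w) \<bullet>c v = w \<bullet>c w"
  proof -
    have "(mat_adjoint A *\<^sub>v w) \<bullet>c v
        = (\<Sum>i<n. \<Sum>j<m. cnj (A $$ (j, i)) * w $ j * cnj (v $ i))"
      using A H w v
      by (auto simp: scalar_prod_def mat_adjoint_index sum_distrib_right lessThan_atLeast0
               intro!: sum.cong)
    also have "\<dots> = (\<Sum>j<m. \<Sum>i<n. cnj (A $$ (j, i)) * w $ j * cnj (v $ i))"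
      by (rule sum.swap)
    also have "\<dots> = (\<Sum>j<m. w $ j * cnj (w $ j))"
      using A v by (auto simp: w_def scalar_prod_def sum_distrib_left lessThan_atLeast0 mult_ac
               intro!: sum.cong)
    also have "\<dots> = w \<bullet>c w"
      using w by (auto simp: scalar_prod_def lessThan_atLeast0)
    finally show ?thesis .
  qed
  moreover have "mat_adjoint A *\<^sub>v w = l \<cdot>\<^sub>v v"
    using e A H v by (simp add: w_def assoc_mult_mat_vec[of _ n m _ n])
  ultimately have eq: "l * (v \<bullet>c v) = w \<bullet>c w"
    using v by simp
  have re: "\<exists>r\<ge>0. u \<bullet>c u = complex_of_real r" if "u \<in> carrier_vec k" for u k
    by (rule exI[of _ "\<Sum>i<k. (cmod (u $ i))\<^sup>2"])
      (use that in \<open>auto simp: scalar_prod_def lessThan_atLeast0 complex_norm_square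
        intro!: sum_nonneg sum.cong simp del: of_real_power\<close>)
  obtain r s where r: "r \<ge> 0" "v \<bullet>c v = complex_of_real r"
    and s: "s \<ge> 0" "w \<bullet>c w = complex_of_real s"
    using re v w by metis
  have "v \<bullet>c v \<noteq> 0" using v conjugate_square_eq_0_vec by blast
  then have "r \<noteq> 0" using r by auto
  then have "l = complex_of_real (s / r)"
    using eq r s by (simp add: field_simps)
  then have "l = complex_of_real ((sqrt (s / r))\<^sup>2)" "0 \<le> sqrt (s / r)"
    using r s by simp_all
  then have "sqrt (s / r) \<in> singular_values A"
    using l unfolding singular_values_def by blast
  then show ?thesis by blast
qed

end

theory Submission
  imports Defs "HOL-Analysis.L2_Norm"
begin

text \<open>
  The point is that \<open>sigma_max\<close>, defined through eigenvalues, bounds the operator norm: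
  \<open>\<parallel>A x\<parallel> \<le> sigma_max A * \<parallel>x\<parallel>\<close>. Instead of diagonalising \<open>A\<^sup>H A\<close> we use the growth of its
  powers. If \<open>N\<close> is Hermitian, then \<open>\<parallel>N\<^sup>k x\<parallel>\<close> is log-convex in \<open>k\<close> by Cauchy-Schwarz, so
  \<open>\<parallel>N x\<parallel> > \<parallel>x\<parallel>\<close> would force geometric growth; this is impossible when the spectral radius of \<open>N\<close>
  is less than \<open>1\<close>, since the Jordan normal form then shows that the powers of \<open>N\<close> are bounded.
  Apply this to \<open>A\<^sup>H A / t\<close> for all \<open>t > (sigma_max A)\<^sup>2\<close>.
  Now an eigenvector \<open>v\<close> for a singular value \<open>s\<close> of \<open>G B\<close> has
  \<open>s \<parallel>v\<parallel> = \<parallel>G B v\<parallel> \<le> sigma_max G * \<parallel>B\<parallel>\<^sub>F * \<parallel>v\<parallel>\<close>.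
\<close>

section \<open>Euclidean norm, adjoints and the Frobenius bound\<close>

definition vec_l2 :: "complex vec \<Rightarrow> real" where
  "vec_l2 v = L2_set (\<lambda>i. cmod (v $ i)) {..<dim_vec v}"

lemma vec_l2_nonneg [simp]: "0 \<le> vec_l2 v"
  by (simp add: vec_l2_def L2_set_nonneg)

lemma vec_l2_sq: "(vec_l2 v)\<^sup>2 = (\<Sum>i<dim_vec v. (cmod (v $ i))\<^sup>2)"
  by (simp add: vec_l2_def L2_set_def sum_nonneg)

lemma cscalar_prod_self: "v \<bullet>c v = complex_of_real ((vec_l2 v)\<^sup>2)"
  by (simp add: vec_l2_sq scalar_prod_def lessThan_atLeast0 complex_norm_square
      del: of_real_power)

lemma vec_l2_pos:
  assumes "v \<in> carrier_vec n" "v \<noteq> 0\<^sub>v n"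
  shows "0 < vec_l2 v"
  using conjugate_square_eq_0_vec[of v n] assms cscalar_prod_self[of v] vec_l2_nonneg[of v]
  by (cases "vec_l2 v = 0") (auto simp: less_le)

lemma vec_l2_smult: "vec_l2 (c \<cdot>\<^sub>v v) = cmod c * vec_l2 v"
  by (simp add: vec_l2_def L2_set_right_distrib norm_mult cong: L2_set_cong_simp)

lemma cscalar_prod_Cauchy_Schwarz:
  assumes "x \<in> carrier_vec n" "y \<in> carrier_vec n"
  shows "cmod (x \<bullet>c y) \<le> vec_l2 x * vec_l2 y"
proof -
  have "cmod (x \<bullet>c y) \<le> (\<Sum>i<n. \<bar>cmod (x $ i)\<bar> * \<bar>cmod (y $ i)\<bar>)"
    using assms
    by (auto simp: scalar_prod_def lessThan_atLeast0 norm_mult intro!: sum_norm_le)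
  also have "\<dots> \<le> vec_l2 x * vec_l2 y"
    using assms L2_set_mult_ineq[of "\<lambda>i. cmod (x $ i)" "\<lambda>i. cmod (y $ i)" "{..<n}"]
    by (simp add: vec_l2_def)
  finally show ?thesis .
qed

lemma cscalar_prod_adjoint:
  fixes A :: "complex mat"
  assumes A: "A \<in> carrier_mat m n" and x: "x \<in> carrier_vec n" and y: "y \<in> carrier_vec m"
  shows "(A *\<^sub>v x) \<bullet>c y = x \<bullet>c (mat_adjoint A *\<^sub>v y)"
proof -
  have H: "mat_adjoint A \<in> carrier_mat n m"
    by (rule mat_adjoint_carrier[OF A])
  have "(A *\<^sub>v x) \<bullet>c y = (\<Sum>j<m. \<Sum>i<n. A $$ (j, i) * x $ i * cnj (y $ j))"
    using A x y
    by (auto simp: scalar_prod_def sum_distrib_right lessThan_atLeast0 intro!: sum.cong)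
  also have "\<dots> = (\<Sum>i<n. \<Sum>j<m. A $$ (j, i) * x $ i * cnj (y $ j))"
    by (rule sum.swap)
  also have "\<dots> = x \<bullet>c (mat_adjoint A *\<^sub>v y)"
    using A H x y
    by (auto simp: scalar_prod_def mat_adjoint_index sum_distrib_left lessThan_atLeast0 mult_ac
        intro!: sum.cong)
  finally show ?thesis .
qed

lemma mat_adjoint_adjoint:
  fixes A :: "complex mat"
  assumes "A \<in> carrier_mat m n"
  shows "mat_adjoint (mat_adjoint A) = A"
  using mat_adjoint_carrier[OF assms] mat_adjoint_carrier[OF mat_adjoint_carrier[OF assms]] assms
  by (intro eq_matI) (auto simp: mat_adjoint_index)

lemma vec_l2_mult_mat_vec_le_frobenius:
  assumes A: "A \<in> carrier_mat m n" and x: "x \<in> carrier_vec n"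
  shows "vec_l2 (A *\<^sub>v x) \<le> frobenius_norm A * vec_l2 x"
proof -
  have row: "(cmod ((A *\<^sub>v x) $ i))\<^sup>2 \<le> (\<Sum>j<n. (cmod (A $$ (i, j)))\<^sup>2) * (vec_l2 x)\<^sup>2"
    if "i < m" for i
  proof -
    \<comment> \<open>The product \<open>\<bullet>c\<close> conjugates its right argument;
      conjugating \<open>x\<close> beforehand cancels this and keeps its norm, so Cauchy-Schwarz
      applies row by row.\<close>
    have "(A *\<^sub>v x) $ i = row A i \<bullet>c conjugate x"
      using A x that by simp
    then have "cmod ((A *\<^sub>v x) $ i) \<le> vec_l2 (row A i) * vec_l2 x"
      using cscalar_prod_Cauchy_Schwarz[of "row A i" n "conjugate x"] A x that
      by (simp add: vec_l2_def cong: L2_set_cong_simp)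
    then have "(cmod ((A *\<^sub>v x) $ i))\<^sup>2 \<le> (vec_l2 (row A i))\<^sup>2 * (vec_l2 x)\<^sup>2"
      using power_mono[of _ _ 2] by (fastforce simp flip: power_mult_distrib)
    then show ?thesis
      using A that by (simp add: vec_l2_sq)
  qed
  have "(vec_l2 (A *\<^sub>v x))\<^sup>2 \<le> (\<Sum>i<m. (\<Sum>j<n. (cmod (A $$ (i, j)))\<^sup>2) * (vec_l2 x)\<^sup>2)"
    unfolding vec_l2_sq[of "A *\<^sub>v x"] using A row by (auto intro!: sum_mono)
  also have "\<dots> = (frobenius_norm A * vec_l2 x)\<^sup>2"
    using A by (simp add: frobenius_norm_def power_mult_distrib sum_nonneg flip: sum_distrib_right)
  finally show ?thesis
    by (rule power2_le_imp_le) (simp add: frobenius_norm_def sum_nonneg)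
qed

text \<open>Turns the entrywise bound that the Jordan normal form yields for matrix powers into one
  that controls their action on vectors.\<close>

lemma frobenius_norm_le_of_norm_bound:
  assumes A: "A \<in> carrier_mat m n" and c: "norm_bound A c"
  shows "frobenius_norm A \<le> sqrt (real m * real n * c\<^sup>2)"
proof -
  have "(\<Sum>i<m. \<Sum>j<n. (cmod (A $$ (i, j)))\<^sup>2) \<le> (\<Sum>i<m. \<Sum>j<n. c\<^sup>2)"
    using A c by (intro sum_mono power_mono) (auto simp: norm_bound_def)
  then show ?thesis
    using A by (simp add: frobenius_norm_def)
qed

section \<open>Growth of the powers of a Hermitian matrix\<close>

lemma hermitian_contraction:
  assumes N: "N \<in> carrier_mat n n" and herm: "mat_adjoint N = N"
    and sr: "spectral_radius N < 1" and x: "x \<in> carrier_vec n"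
  shows "vec_l2 (N *\<^sub>v x) \<le> vec_l2 x"
proof (rule ccontr)
  define y where "y k = (N ^\<^sub>m k) *\<^sub>v x" for k
  define b where "b k = vec_l2 (y k)" for k
  have Nk: "N ^\<^sub>m k \<in> carrier_mat n n" for k
    using N by simp
  have y: "y k \<in> carrier_vec n" for k
    unfolding y_def using Nk x by (rule mult_mat_vec_carrier)
  \<comment> \<open>Powers are defined with the new factor on the right; the orbit \<open>y\<close>
    needs it on the left.\<close>
  have "N ^\<^sub>m Suc k = N * N ^\<^sub>m k" for k
    by (induction k) (use N Nk in \<open>auto simp: assoc_mult_mat[of _ n n _ n _ n]\<close>)
  then have y_Suc: "y (Suc k) = N *\<^sub>v y k" for k
    using N Nk x by (simp add: y_def assoc_mult_mat_vec[of _ n n _ n])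
  have y0: "y 0 = x"
    using N x by (simp add: y_def)
  assume "\<not> ?thesis"
  then have b01: "b 0 < b 1"
    by (simp add: b_def y_Suc y0)
  have b_nonneg: "0 \<le> b k" for k
    by (simp add: b_def)
  have log_convex: "(b (Suc k))\<^sup>2 \<le> b k * b (Suc (Suc k))" for k
  proof -
    \<comment> \<open>One factor \<open>N\<close> of \<open>y (Suc k)\<close> moves across the inner
      product because \<open>N\<close> is Hermitian.\<close>
    have "complex_of_real ((b (Suc k))\<^sup>2) = (N *\<^sub>v y k) \<bullet>c y (Suc k)"
      unfolding b_def y_Suc[symmetric] by (rule cscalar_prod_self[symmetric])
    also have "\<dots> = y k \<bullet>c y (Suc (Suc k))"
      using cscalar_prod_adjoint[OF N y y, of k "Suc k"] by (simp add: herm y_Suc)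
    finally have "(b (Suc k))\<^sup>2 = cmod (y k \<bullet>c y (Suc (Suc k)))"
      by (metis norm_of_real abs_power2)
    then show ?thesis
      using cscalar_prod_Cauchy_Schwarz[OF y y] by (simp add: b_def)
  qed
  obtain c where c: "norm_bound (N ^\<^sub>m k) c" for k
    using spectral_radius_jnf_norm_bound_less_1_upper_triangular[OF N sr] by blast
  have bounded: "b k \<le> sqrt (real n * real n * c\<^sup>2) * b 0" for k
    using vec_l2_mult_mat_vec_le_frobenius[OF Nk x]
      mult_right_mono[OF frobenius_norm_le_of_norm_bound[OF Nk c] vec_l2_nonneg]
    by (force simp: b_def y_def[of k] y0 intro: order_trans)
  \<comment> \<open>If \<open>b 0\<close> were 0, the bound would give \<open>b 1 \<le> 0\<close>,
    against \<open>b 0 < b 1\<close>.\<close>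
  have b0: "0 < b 0"
    using bounded[of 1] b01 b_nonneg[of 0] by (cases "b 0 = 0") auto
  define r where "r = b 1 / b 0"
  have r: "1 < r"
    using b0 b01 by (simp add: r_def)
  \<comment> \<open>Log-convexity says that successive ratios of \<open>b\<close> never decrease, so
    they stay at least the first one, \<open>r\<close>. Positivity is carried along so that
    \<open>b k\<close> can be cancelled.\<close>
  have step: "0 < b k \<and> r * b k \<le> b (Suc k)" for k
  proof (induction k)
    case 0
    then show ?case using b0 by (simp add: r_def)
  next
    case (Suc k)
    have pos: "0 < b (Suc k)"
      using Suc r by (smt (verit) mult_pos_pos)
    have "b k * (r * b (Suc k)) \<le> (b (Suc k))\<^sup>2"
      using mult_right_mono[of "r * b k" "b (Suc k)" "b (Suc k)"] Suc pos
      by (simp add: power2_eq_square mult_ac)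
    also note log_convex
    finally show ?case
      using Suc pos by simp
  qed
  have growth: "r ^ k * b 0 \<le> b k" for k
  proof (induction k)
    case (Suc k)
    have "r ^ Suc k * b 0 \<le> r * b k"
      using mult_left_mono[OF Suc, of r] r by (simp add: mult_ac)
    then show ?case
      using step[of k] by simp
  qed simp
  \<comment> \<open>The constant does not depend on \<open>k\<close>, so geometric growth overtakes
    it.\<close>
  obtain k where "sqrt (real n * real n * c\<^sup>2) < r ^ k"
    using real_arch_pow[OF r] by blast
  then show False
    using growth[of k] bounded[of k] b0 by (smt (verit) mult_strict_right_mono)
qed

section \<open>The Gram matrix and the operator norm\<close>

lemma smult_mat_mult_vec:
  assumes "A \<in> carrier_mat m n" "v \<in> carrier_vec n"
  shows "(c \<cdot>\<^sub>m A) *\<^sub>v v = c \<cdot>\<^sub>v (A *\<^sub>v v)"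
  using assms by (intro eq_vecI) (auto simp: smult_scalar_prod_distrib[of _ n])

lemma gram_carrier:
  fixes A :: "complex mat"
  assumes "A \<in> carrier_mat m n"
  shows "mat_adjoint A * A \<in> carrier_mat n n"
  using assms mat_adjoint_carrier[OF assms] by simp

lemma gram_cscalar_prod:
  assumes A: "A \<in> carrier_mat m n" and x: "x \<in> carrier_vec n"
  shows "((mat_adjoint A * A) *\<^sub>v x) \<bullet>c x = complex_of_real ((vec_l2 (A *\<^sub>v x))\<^sup>2)"
proof -
  have H: "mat_adjoint A \<in> carrier_mat n m"
    by (rule mat_adjoint_carrier[OF A])
  have Ax: "A *\<^sub>v x \<in> carrier_vec m"
    using A x by simp
  have "((mat_adjoint A * A) *\<^sub>v x) \<bullet>c x = (mat_adjoint A *\<^sub>v (A *\<^sub>v x)) \<bullet>c x"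
    using A H x by (simp add: assoc_mult_mat_vec[of _ n m _ n])
  also have "\<dots> = (A *\<^sub>v x) \<bullet>c (A *\<^sub>v x)"
    using cscalar_prod_adjoint[OF H Ax x] by (simp add: mat_adjoint_adjoint[OF A])
  finally show ?thesis
    by (simp add: cscalar_prod_self)
qed

text \<open>Pair the eigenvalue equation with \<open>v\<close>: \<open>l\<close> is a Rayleigh
  quotient, hence real and nonnegative, with square root the factor by which \<open>A\<close>
  stretches \<open>v\<close>.\<close>

lemma gram_eigenvector:
  assumes A: "A \<in> carrier_mat m n" and v: "eigenvector (mat_adjoint A * A) v l"
  shows "l * complex_of_real ((vec_l2 v)\<^sup>2) = complex_of_real ((vec_l2 (A *\<^sub>v v))\<^sup>2)"
    and "v \<in> carrier_vec n" and "0 < vec_l2 v"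
proof -
  show c: "v \<in> carrier_vec n" and "0 < vec_l2 v"
    using v gram_carrier[OF A] vec_l2_pos by (auto simp: eigenvector_def)
  have "(mat_adjoint A * A) *\<^sub>v v = l \<cdot>\<^sub>v v"
    using v by (simp add: eigenvector_def)
  then show "l * complex_of_real ((vec_l2 v)\<^sup>2) = complex_of_real ((vec_l2 (A *\<^sub>v v))\<^sup>2)"
    using gram_cscalar_prod[OF A c] c by (simp add: cscalar_prod_self)
qed

lemma sigma_max_ge:
  assumes "s \<in> singular_values A"
  shows "s \<le> sigma_max A"
  unfolding sigma_max_def using finite_singular_values assms by (rule Max_ge)

text \<open>With no columns the Gram matrix has no eigenvalue and the maximum would be over the
  empty set; hence \<open>0 < n\<close>.\<close>

lemma sigma_max_mem:
  assumes "A \<in> carrier_mat m n" "0 < n"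
  shows "sigma_max A \<in> singular_values A"
  unfolding sigma_max_def
  using finite_singular_values singular_values_nonempty assms by (intro Max_in) auto

lemma sigma_max_nonneg:
  assumes "A \<in> carrier_mat m n" "0 < n"
  shows "0 \<le> sigma_max A"
  using sigma_max_mem[OF assms] by (simp add: singular_values_def)

text \<open>Singular values only record eigenvalues that are squares of nonnegative reals. Every
  complex eigenvalue of the Gram matrix is of this form, so the whole spectrum is
  controlled.\<close>

lemma norm_gram_eigenvalue_le:
  assumes A: "A \<in> carrier_mat m n" and l: "eigenvalue (mat_adjoint A * A) l"
  shows "cmod l \<le> (sigma_max A)\<^sup>2"
proof -
  obtain v where v: "eigenvector (mat_adjoint A * A) v l"
    using l by (auto simp: eigenvalue_def)
  define s where "s = vec_l2 (A *\<^sub>v v) / vec_l2 v"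
  have s: "l = complex_of_real (s\<^sup>2)" "0 \<le> s"
    using gram_eigenvector[OF A v] by (auto simp: s_def field_simps)
  then have "s \<in> singular_values A"
    using l by (simp add: singular_values_def)
  then have "s\<^sup>2 \<le> (sigma_max A)\<^sup>2"
    using sigma_max_ge s(2) power_mono by blast
  then show ?thesis
    by (simp only: s(1) norm_of_real abs_power2)
qed

lemma vec_l2_mult_mat_vec_le_sigma_max:
  assumes A: "A \<in> carrier_mat m n" and x: "x \<in> carrier_vec n" and n: "0 < n"
  shows "vec_l2 (A *\<^sub>v x) \<le> sigma_max A * vec_l2 x"
proof -
  let ?M = "mat_adjoint A * A"
  have M: "?M \<in> carrier_mat n n"
    by (rule gram_carrier[OF A])
  have H: "mat_adjoint A \<in> carrier_mat n m"
    by (rule mat_adjoint_carrier[OF A])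
  \<comment> \<open>The strict inequality makes the spectral radius of \<open>?M / t\<close>
    strictly less than 1 and keeps \<open>t\<close> positive even if \<open>sigma_max A\<close> is
    0.\<close>
  have bound: "vec_l2 (?M *\<^sub>v x) \<le> t * vec_l2 x" if t: "(sigma_max A)\<^sup>2 < t" for t
  proof -
    have tpos: "0 < t"
      using t by (smt (verit) zero_le_power2)
    define N where "N = complex_of_real (1 / t) \<cdot>\<^sub>m ?M"
    have N: "N \<in> carrier_mat n n"
      using M by (simp add: N_def)
    have herm_M: "conjugate (?M $$ (j, i)) = ?M $$ (i, j)" if "i < n" "j < n" for i j
      using A H that
      by (auto simp: scalar_prod_def mat_adjoint_index mult_ac intro!: sum.cong)
    have "conjugate (N $$ (j, i)) = N $$ (i, j)" if "i < n" "j < n" for i j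
      using herm_M[OF that] A H that by (simp add: N_def del: index_mult_mat(1))
    then have herm: "mat_adjoint N = N"
      using N mat_adjoint_carrier[OF N]
      by (intro eq_matI) (auto simp: mat_adjoint_index[OF N])
    obtain l where l: "eigenvalue N l" "spectral_radius N = cmod l"
      using spectral_radius_mem_max(1)[OF N n] by (auto simp: spectrum_def)
    then obtain v where v: "v \<in> carrier_vec n" "v \<noteq> 0\<^sub>v n" "N *\<^sub>v v = l \<cdot>\<^sub>v v"
      using N by (auto simp: eigenvalue_def eigenvector_def)
    have N_mult: "N *\<^sub>v w = complex_of_real (1 / t) \<cdot>\<^sub>v (?M *\<^sub>v w)" if "w \<in> carrier_vec n" for w
      unfolding N_def by (rule smult_mat_mult_vec[OF M that])
    \<comment> \<open>Undo the scaling: an eigenvalue of \<open>N\<close> of largest modulus, times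
      \<open>t\<close>, is an eigenvalue of \<open>?M\<close>.\<close>
    have "?M *\<^sub>v v = complex_of_real t \<cdot>\<^sub>v (N *\<^sub>v v)"
      using tpos M v(1) by (simp add: N_mult smult_smult_assoc)
    then have "eigenvalue ?M (complex_of_real t * l)"
      using v H unfolding eigenvalue_def eigenvector_def
      by (intro exI[of _ v]) (auto simp: smult_smult_assoc)
    from norm_gram_eigenvalue_le[OF A this] have "t * cmod l \<le> (sigma_max A)\<^sup>2"
      using tpos by (simp add: norm_mult)
    also note t
    finally have "cmod l < 1"
      using tpos by simp
    then have "spectral_radius N < 1"
      using l by simp
    then have "vec_l2 (N *\<^sub>v x) \<le> vec_l2 x"
      using hermitian_contraction N herm x by blast
    then show ?thesis
      using tpos by (simp add: N_mult[OF x] vec_l2_smult norm_divide field_simps)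
  qed
  have "(vec_l2 (A *\<^sub>v x))\<^sup>2 \<le> (sigma_max A)\<^sup>2 * (vec_l2 x)\<^sup>2"
  proof (cases "vec_l2 x = 0")
    case True
    then show ?thesis
      using vec_l2_mult_mat_vec_le_frobenius[OF A x] vec_l2_nonneg[of "A *\<^sub>v x"] by simp
  next
    case False
    then have xpos: "0 < vec_l2 x"
      by (simp add: less_le)
    \<comment> \<open>Let \<open>t\<close> decrease to \<open>(sigma_max A)\<^sup>2\<close>.\<close>
    have "vec_l2 (?M *\<^sub>v x) / vec_l2 x \<le> (sigma_max A)\<^sup>2"
      by (rule dense_ge) (use bound xpos in \<open>simp add: field_simps\<close>)
    then have M_le: "vec_l2 (?M *\<^sub>v x) \<le> (sigma_max A)\<^sup>2 * vec_l2 x"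
      using xpos by (simp add: field_simps)
    \<comment> \<open>Cauchy-Schwarz on this quadratic form carries the bound for \<open>?M\<close>
      back to \<open>A\<close>.\<close>
    have "(vec_l2 (A *\<^sub>v x))\<^sup>2 = cmod ((?M *\<^sub>v x) \<bullet>c x)"
      by (simp only: gram_cscalar_prod[OF A x] norm_of_real abs_power2)
    also have "\<dots> \<le> vec_l2 (?M *\<^sub>v x) * vec_l2 x"
      using M x by (intro cscalar_prod_Cauchy_Schwarz) auto
    also have "\<dots> \<le> (sigma_max A)\<^sup>2 * vec_l2 x * vec_l2 x"
      using M_le by (rule mult_right_mono) simp
    finally show ?thesis
      by (simp add: power2_eq_square mult_ac)
  qed
  then have "(vec_l2 (A *\<^sub>v x))\<^sup>2 \<le> (sigma_max A * vec_l2 x)\<^sup>2"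
    by (simp add: power_mult_distrib)
  then show ?thesis
    by (rule power2_le_imp_le) (simp add: sigma_max_nonneg[OF A n])
qed

section \<open>Singular values of a product and the power constraint\<close>

lemma sigma_max_mult_le:
  assumes G: "G \<in> carrier_mat m l" and B: "B \<in> carrier_mat l n" and l: "0 < l" and n: "0 < n"
  shows "sigma_max (G * B) \<le> sigma_max G * frobenius_norm B"
proof -
  have GB: "G * B \<in> carrier_mat m n"
    using G B by simp
  let ?s = "sigma_max (G * B)"
  have s: "0 \<le> ?s" "eigenvalue (mat_adjoint (G * B) * (G * B)) (complex_of_real (?s\<^sup>2))"
    using sigma_max_mem[OF GB n] by (auto simp: singular_values_def)
  then obtain v where v: "eigenvector (mat_adjoint (G * B) * (G * B)) v (complex_of_real (?s\<^sup>2))"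
    by (auto simp: eigenvalue_def)
  note e = gram_eigenvector[OF GB v]
  have Bv: "B *\<^sub>v v \<in> carrier_vec l"
    using B e(2) by simp
  have "?s\<^sup>2 * (vec_l2 v)\<^sup>2 = (vec_l2 ((G * B) *\<^sub>v v))\<^sup>2"
    using e(1) by (simp only: of_real_mult[symmetric] of_real_eq_iff)
  then have "(?s * vec_l2 v)\<^sup>2 = (vec_l2 ((G * B) *\<^sub>v v))\<^sup>2"
    by (simp add: power_mult_distrib)
  then have "?s * vec_l2 v = vec_l2 (G *\<^sub>v (B *\<^sub>v v))"
    using s(1) assoc_mult_mat_vec[OF G B e(2)] by (simp add: power2_eq_iff_nonneg)
  also have "\<dots> \<le> sigma_max G * vec_l2 (B *\<^sub>v v)"
    by (rule vec_l2_mult_mat_vec_le_sigma_max[OF G Bv l])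
  also have "\<dots> \<le> sigma_max G * (frobenius_norm B * vec_l2 v)"
    using vec_l2_mult_mat_vec_le_frobenius[OF B e(2)] sigma_max_nonneg[OF G l]
    by (rule mult_left_mono)
  finally show ?thesis
    using e(3) by (simp flip: mult.assoc)
qed

theorem theorem2:
  fixes H_ii F_RF :: "complex mat"
    and N_t N_r L_t N_s :: nat
    and \<eta>_LNA :: real
  assumes "N_t \<ge> 1" and "N_r \<ge> 1" and "L_t \<ge> 1" and "N_s \<ge> 1"
    and "H_ii \<in> carrier_mat N_r N_t"
    and "F_RF \<in> carrier_mat N_t L_t"
    and "\<eta>_LNA \<ge> 0"
    and "\<eta>_LNA \<ge> 1 / real N_s * (sigma_max (H_ii * F_RF))\<^sup>2"
  shows "\<forall>F_BB \<in> carrier_mat L_t N_s. (frobenius_norm F_BB)\<^sup>2 \<le> 1 \<longrightarrow>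
           1 / real N_s * (sigma_max (H_ii * F_RF * F_BB))\<^sup>2 \<le> \<eta>_LNA"
proof (intro ballI impI)
  fix F_BB
  assume B: "F_BB \<in> carrier_mat L_t N_s" and power: "(frobenius_norm F_BB)\<^sup>2 \<le> 1"
  let ?G = "H_ii * F_RF"
  have G: "?G \<in> carrier_mat N_r L_t" and pos: "0 < L_t" "0 < N_s"
    using assms by auto
  \<comment> \<open>Needed to square the product bound.\<close>
  have "0 \<le> sigma_max (?G * F_BB)"
    using sigma_max_nonneg[of "?G * F_BB" N_r N_s] G B pos by simp
  then have "(sigma_max (?G * F_BB))\<^sup>2 \<le> (sigma_max ?G)\<^sup>2 * (frobenius_norm F_BB)\<^sup>2"
    using power_mono[OF sigma_max_mult_le[OF G B pos], of 2] by (simp add: power_mult_distrib)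
  also have "\<dots> \<le> (sigma_max ?G)\<^sup>2"
    using mult_left_mono[OF power, of "(sigma_max ?G)\<^sup>2"] by simp
  finally have "1 / real N_s * (sigma_max (?G * F_BB))\<^sup>2 \<le> 1 / real N_s * (sigma_max ?G)\<^sup>2"
    by (rule mult_left_mono) simp
  with assms(8) show "1 / real N_s * (sigma_max (?G * F_BB))\<^sup>2 \<le> \<eta>_LNA"
    by simp
qed

end
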